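(* Let $\mathcal G$ be a Lie groupoid, $M$ a smooth manifold, and let $\sigma$ be a bundle morphism from the principal $\mathcal G$-bundle $P_1$ over $M$ to the principal $\mathcal G$-bundle $P_2$ over $M$. Then $$\phi_{P_2}\circ(\sigma\times\sigma)=\phi_{P_1}\quad\text{on } P_1\odot P_1,$$ where $\phi_{P_1},\phi_{P_2}$ are the division maps of $P_1$ and $P_2$.
   Context: Lie groupoids: a groupoid has a set of arrows $\mathcal G$, a set of objects $X_{\mathcal G}$, surjective source and target maps $s_{\mathcal G},t_{\mathcal G}:\mathcal G\to X_{\mathcal G}$, a unit map $\iota_{\mathcal G}:X_{\mathcal G}\to\mathcal G$, an inversion $g\mapsto g^{-1}$, and an associative product $g_1g_2$ defined iff $s_{\mathcal G}(g_1)=t_{\mathcal G}(g_2)$, with $s_{\mathcal G}(g_1g_2)=s_{\mathcal G}(g_2)$, $t_{\mathcal G}(g_1g_2)=t_{\mathcal G}(g_1)$ and the usual unit and inverse laws. It is a Lie groupoid if $X_{\mathcal G}$ is a smooth Hausdorff manifold, $\mathcal G$ is a smooth manifold (possibly non-Hausdorff, not second countable), $s_{\mathcal G}$ is a surjective submersion with Hausdorff fibres, and all other structure maps are smooth. Right action of $\mathcal G$ on a manifold $P$ with momentum $\varepsilon$: a smooth map $\varepsilon:P\to X_{\mathcal G}$ and a smooth map $(p,g)\mapsto pg$ from $P\times_\varepsilon\mathcal G=\{(p,g): \varepsilon(p)=t_{\mathcal G}(g)\}$ to $P$ with $\varepsilon(pg)=s_{\mathcal G}(g)$, $(pg)h=p(gh)$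 whenever defined, and $p\,\iota_{\mathcal G}(\varepsilon(p))=p$. Principal $\mathcal G$-bundle $(P,\pi,\varepsilon,M)$ over $M$: smooth manifolds $P$ (possibly non-Hausdorff) and $M$ (Hausdorff), a right $\mathcal G$-action on $P$ with momentum $\varepsilon$, and a surjective submersion $\pi:P\to M$ with $\pi(pg)=\pi(p)$ such that $P\times_\varepsilon\mathcal G\to P\odot P$, $(p,g)\mapsto(p,pg)$, is a diffeomorphism, where $P\odot P=\{(p,q)\in P\times P:\pi(p)=\pi(q)\}$. The division map $\phi_P:P\odot P\to\mathcal G$ is the second component of the inverse of this diffeomorphism; it is the unique map with $t_{\mathcal G}(\phi_P(p,q))=\varepsilon(p)$ and $q=p\,\phi_P(p,q)$. Bundle morphism from $(P_1,\pi_1,\varepsilon_1,M)$ to $(P_2,\pi_2,\varepsilon_2,M)$: a smooth map $\sigma:P_1\to P_2$ with $\pi_2\circ\sigma=\pi_1$, $\varepsilon_2\circ\sigma=\varepsilon_1$ and $\sigma(pg)=\sigma(p)g$ for all $(p,g)\in P_1\times_{\varepsilon_1}\mathcal G$. *)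

theory Defs
  imports "HOL-Analysis.Analysis"
begin

section \<open>Smooth maps between open subsets of Euclidean spaces\<close>

text \<open>
  Coordinates take values in \<^term>\<open>Euclidean_space n\<close> (functions \<^typ>\<open>nat \<Rightarrow> real\<close> vanishing from
  index \<open>n\<close> on), so that the dimension is a number, may be \<open>0\<close>, and \<open>\<real>\<^sup>k\<close> is literally a subset of
  \<open>\<real>\<^sup>n\<close> for \<open>k \<le> n\<close>.
\<close>

definition pderiv_at :: "nat \<Rightarrow> ((nat \<Rightarrow> real) \<Rightarrow> real) \<Rightarrow> (nat \<Rightarrow> real) \<Rightarrow> real" where
  "pderiv_at i f x = deriv (\<lambda>t. f (x(i := t))) (x i)"

text \<open>\<open>Ck_on n k U f\<close>: all partial derivatives of \<open>f\<close> of order at most \<open>k\<close> exist and are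
  continuous on the open subset \<open>U\<close> of \<open>\<real>\<^sup>n\<close>.\<close>

primrec Ck_on :: "nat \<Rightarrow> nat \<Rightarrow> (nat \<Rightarrow> real) set \<Rightarrow> ((nat \<Rightarrow> real) \<Rightarrow> real) \<Rightarrow> bool" where
  "Ck_on n 0 U f \<longleftrightarrow>
     continuous_map (subtopology (Euclidean_space n) U) euclideanreal f"
| "Ck_on n (Suc k) U f \<longleftrightarrow>
     continuous_map (subtopology (Euclidean_space n) U) euclideanreal f \<and>
     (\<forall>i<n. (\<forall>x\<in>U. (\<lambda>t. f (x(i := t))) field_differentiable at (x i)) \<and>
            Ck_on n k U (pderiv_at i f))"

definition smooth_on :: "nat \<Rightarrow> (nat \<Rightarrow> real) set \<Rightarrow> ((nat \<Rightarrow> real) \<Rightarrow> (nat \<Rightarrow> real)) \<Rightarrow> bool" where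
  "smooth_on n U F \<longleftrightarrow> (\<forall>j k. Ck_on n k U (\<lambda>x. F x j))"

section \<open>Smooth manifolds, not necessarily Hausdorff or second countable\<close>

text \<open>A chart is a triple of dimension, domain and coordinate map; the values of the coordinate map
  outside the domain do not matter. Different components of a manifold may have different
  dimensions.\<close>

type_synonym 'a chart = "nat \<times> 'a set \<times> ('a \<Rightarrow> nat \<Rightarrow> real)"

record 'a mfd =
  mtop :: "'a topology"
  atlas :: "'a chart set"

abbreviation pts :: "'a mfd \<Rightarrow> 'a set" where
  "pts M \<equiv> topspace (mtop M)"

definition is_chart :: "'a topology \<Rightarrow> 'a chart \<Rightarrow> bool" where
  "is_chart T = (\<lambda>(n, U, \<phi>).
     openin T U \<and> openin (Euclidean_space n) (\<phi> ` U) \<and>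
     homeomorphic_map (subtopology T U) (subtopology (Euclidean_space n) (\<phi> ` U)) \<phi>)"

definition smooth_in_charts :: "'a chart \<Rightarrow> 'b chart \<Rightarrow> ('a \<Rightarrow> 'b) \<Rightarrow> bool" where
  "smooth_in_charts = (\<lambda>(m, U, \<phi>) (n, V, \<psi>) f.
     smooth_on m (\<phi> ` (U \<inter> f -` V)) (\<psi> \<circ> f \<circ> inv_into U \<phi>))"

definition compatible :: "'a chart \<Rightarrow> 'a chart \<Rightarrow> bool" where
  "compatible c d \<longleftrightarrow> smooth_in_charts c d id \<and> smooth_in_charts d c id"

definition smooth_manifold :: "'a mfd \<Rightarrow> bool" where
  "smooth_manifold M \<longleftrightarrow>
     (\<forall>c\<in>atlas M. is_chart (mtop M) c) \<and>
     (\<forall>c\<in>atlas M. \<forall>d\<in>atlas M. compatible c d) \<and>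
     (\<Union>(n, U, \<phi>)\<in>atlas M. U) = pts M"

definition max_atlas :: "'a mfd \<Rightarrow> 'a chart set" where
  "max_atlas M = {c. is_chart (mtop M) c \<and> (\<forall>d\<in>atlas M. compatible c d)}"

definition smooth_map :: "'a mfd \<Rightarrow> 'b mfd \<Rightarrow> ('a \<Rightarrow> 'b) \<Rightarrow> bool" where
  "smooth_map M N f \<longleftrightarrow>
     continuous_map (mtop M) (mtop N) f \<and>
     (\<forall>c\<in>atlas M. \<forall>d\<in>atlas N. smooth_in_charts c d f)"

definition diffeomorphism :: "'a mfd \<Rightarrow> 'b mfd \<Rightarrow> ('a \<Rightarrow> 'b) \<Rightarrow> bool" where
  "diffeomorphism M N f \<longleftrightarrow>
     bij_betw f (pts M) (pts N) \<and> smooth_map M N f \<and> smooth_map N M (inv_into (pts M) f)"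

text \<open>The differential is expressed by its Jacobian matrix in charts.\<close>

definition submersion :: "'a mfd \<Rightarrow> 'b mfd \<Rightarrow> ('a \<Rightarrow> 'b) \<Rightarrow> bool" where
  "submersion M N f \<longleftrightarrow>
     smooth_map M N f \<and>
     (\<forall>(m, U, \<phi>)\<in>atlas M. \<forall>(n, V, \<psi>)\<in>atlas N. \<forall>p\<in>U. f p \<in> V \<longrightarrow>
        (\<forall>w. \<exists>v. \<forall>j<n.
           (\<Sum>i<m. pderiv_at i (\<lambda>x. (\<psi> \<circ> f \<circ> inv_into U \<phi>) x j) (\<phi> p) * v i) = (w j :: real)))"

definition prod_chart :: "'a chart \<Rightarrow> 'b chart \<Rightarrow> ('a \<times> 'b) chart" where
  "prod_chart = (\<lambda>(m, U, \<phi>) (n, V, \<psi>).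
     (m + n, U \<times> V, \<lambda>(x, y) i. if i < m then \<phi> x i else \<psi> y (i - m)))"

definition prod_mfd :: "'a mfd \<Rightarrow> 'b mfd \<Rightarrow> ('a \<times> 'b) mfd" where
  "prod_mfd M N =
     \<lparr>mtop = prod_topology (mtop M) (mtop N),
      atlas = {prod_chart c d |c d. c \<in> atlas M \<and> d \<in> atlas N}\<rparr>"

text \<open>The structure induced on an embedded submanifold \<open>S\<close>: its charts are the restrictions of the
  slice charts of the ambient manifold, i.e. of those charts (of the maximal atlas) in which \<open>S\<close>
  corresponds to a coordinate subspace \<open>\<real>\<^sup>k \<subseteq> \<real>\<^sup>n\<close>. It is only applied to fibre products over
  submersions, which are embedded submanifolds.\<close>

definition submfd :: "'a mfd \<Rightarrow> 'a set \<Rightarrow> 'a mfd" where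
  "submfd M S =
     \<lparr>mtop = subtopology (mtop M) S,
      atlas = {(k, U \<inter> S, \<phi>) |k n U \<phi>. (n, U, \<phi>) \<in> max_atlas M \<and> k \<le> n \<and>
                 \<phi> ` (U \<inter> S) = \<phi> ` U \<inter> topspace (Euclidean_space k)}\<rparr>"

section \<open>Lie groupoids\<close>

record ('g, 'x) groupoid =
  Arr :: "'g mfd"
  Obj :: "'x mfd"
  src :: "'g \<Rightarrow> 'x"
  tgt :: "'g \<Rightarrow> 'x"
  uni :: "'x \<Rightarrow> 'g"
  ginv :: "'g \<Rightarrow> 'g"
  gmul :: "'g \<Rightarrow> 'g \<Rightarrow> 'g"

definition composable :: "('g, 'x) groupoid \<Rightarrow> ('g \<times> 'g) set" where
  "composable G = {(g, h). g \<in> pts (Arr G) \<and> h \<in> pts (Arr G) \<and> src G g = tgt G h}"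

definition is_groupoid :: "('g, 'x) groupoid \<Rightarrow> bool" where
  "is_groupoid G \<longleftrightarrow>
     src G ` pts (Arr G) = pts (Obj G) \<and>
     tgt G ` pts (Arr G) = pts (Obj G) \<and>
     uni G \<in> pts (Obj G) \<rightarrow> pts (Arr G) \<and>
     ginv G \<in> pts (Arr G) \<rightarrow> pts (Arr G) \<and>
     (\<forall>(g, h)\<in>composable G. gmul G g h \<in> pts (Arr G) \<and>
        src G (gmul G g h) = src G h \<and> tgt G (gmul G g h) = tgt G g) \<and>
     (\<forall>g h k. (g, h) \<in> composable G \<longrightarrow> (h, k) \<in> composable G \<longrightarrow>
        gmul G (gmul G g h) k = gmul G g (gmul G h k)) \<and>
     (\<forall>x\<in>pts (Obj G). src G (uni G x) = x \<and> tgt G (uni G x) = x) \<and>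
     (\<forall>g\<in>pts (Arr G). gmul G g (uni G (src G g)) = g \<and> gmul G (uni G (tgt G g)) g = g) \<and>
     (\<forall>g\<in>pts (Arr G). src G (ginv G g) = tgt G g \<and> tgt G (ginv G g) = src G g \<and>
        gmul G g (ginv G g) = uni G (tgt G g) \<and> gmul G (ginv G g) g = uni G (src G g))"

definition lie_groupoid :: "('g, 'x) groupoid \<Rightarrow> bool" where
  "lie_groupoid G \<longleftrightarrow>
     is_groupoid G \<and>
     smooth_manifold (Obj G) \<and> Hausdorff_space (mtop (Obj G)) \<and>
     smooth_manifold (Arr G) \<and>
     submersion (Arr G) (Obj G) (src G) \<and>
     (\<forall>x\<in>pts (Obj G). Hausdorff_space (subtopology (mtop (Arr G)) {g \<in> pts (Arr G). src G g = x})) \<and>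
     smooth_map (Arr G) (Obj G) (tgt G) \<and>
     smooth_map (Obj G) (Arr G) (uni G) \<and>
     smooth_map (Arr G) (Arr G) (ginv G) \<and>
     smooth_map (submfd (prod_mfd (Arr G) (Arr G)) (composable G)) (Arr G) (\<lambda>(g, h). gmul G g h)"

section \<open>Actions and principal bundles\<close>

definition act_dom :: "('g, 'x) groupoid \<Rightarrow> 'p mfd \<Rightarrow> ('p \<Rightarrow> 'x) \<Rightarrow> ('p \<times> 'g) set" where
  "act_dom G P \<epsilon> = {(p, g). p \<in> pts P \<and> g \<in> pts (Arr G) \<and> \<epsilon> p = tgt G g}"

definition act_mfd :: "('g, 'x) groupoid \<Rightarrow> 'p mfd \<Rightarrow> ('p \<Rightarrow> 'x) \<Rightarrow> ('p \<times> 'g) mfd" where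
  "act_mfd G P \<epsilon> = submfd (prod_mfd P (Arr G)) (act_dom G P \<epsilon>)"

definition right_action ::
  "('g, 'x) groupoid \<Rightarrow> 'p mfd \<Rightarrow> ('p \<Rightarrow> 'x) \<Rightarrow> ('p \<Rightarrow> 'g \<Rightarrow> 'p) \<Rightarrow> bool" where
  "right_action G P \<epsilon> act \<longleftrightarrow>
     smooth_map P (Obj G) \<epsilon> \<and>
     smooth_map (act_mfd G P \<epsilon>) P (\<lambda>(p, g). act p g) \<and>
     (\<forall>(p, g)\<in>act_dom G P \<epsilon>. \<epsilon> (act p g) = src G g) \<and>
     (\<forall>p g h. (p, g) \<in> act_dom G P \<epsilon> \<longrightarrow> (g, h) \<in> composable G \<longrightarrow>
        act (act p g) h = act p (gmul G g h)) \<and>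
     (\<forall>p\<in>pts P. act p (uni G (\<epsilon> p)) = p)"

record ('p, 'm, 'x, 'g) gbundle =
  tot :: "'p mfd"
  proj :: "'p \<Rightarrow> 'm"
  mom :: "'p \<Rightarrow> 'x"
  act :: "'p \<Rightarrow> 'g \<Rightarrow> 'p"

definition odot :: "('p, 'm, 'x, 'g) gbundle \<Rightarrow> ('p \<times> 'p) set" where
  "odot P = {(p, q). p \<in> pts (tot P) \<and> q \<in> pts (tot P) \<and> proj P p = proj P q}"

definition shear :: "('p, 'm, 'x, 'g) gbundle \<Rightarrow> 'p \<times> 'g \<Rightarrow> 'p \<times> 'p" where
  "shear P = (\<lambda>(p, g). (p, act P p g))"

definition principal_bundle ::
  "('g, 'x) groupoid \<Rightarrow> 'm mfd \<Rightarrow> ('p, 'm, 'x, 'g) gbundle \<Rightarrow> bool" where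
  "principal_bundle G M P \<longleftrightarrow>
     smooth_manifold (tot P) \<and>
     smooth_manifold M \<and> Hausdorff_space (mtop M) \<and>
     right_action G (tot P) (mom P) (act P) \<and>
     submersion (tot P) M (proj P) \<and> proj P ` pts (tot P) = pts M \<and>
     (\<forall>(p, g)\<in>act_dom G (tot P) (mom P). proj P (act P p g) = proj P p) \<and>
     diffeomorphism (act_mfd G (tot P) (mom P))
       (submfd (prod_mfd (tot P) (tot P)) (odot P)) (shear P)"

definition division_map ::
  "('g, 'x) groupoid \<Rightarrow> ('p, 'm, 'x, 'g) gbundle \<Rightarrow> 'p \<times> 'p \<Rightarrow> 'g" where
  "division_map G P = snd \<circ> inv_into (act_dom G (tot P) (mom P)) (shear P)"

definition bundle_morphism ::
  "('g, 'x) groupoid \<Rightarrow> ('p, 'm, 'x, 'g) gbundle \<Rightarrow> ('q, 'm, 'x, 'g) gbundle \<Rightarrow> ('p \<Rightarrow> 'q) \<Rightarrow> bool" where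
  "bundle_morphism G P1 P2 \<sigma> \<longleftrightarrow>
     smooth_map (tot P1) (tot P2) \<sigma> \<and>
     (\<forall>p\<in>pts (tot P1). proj P2 (\<sigma> p) = proj P1 p) \<and>
     (\<forall>p\<in>pts (tot P1). mom P2 (\<sigma> p) = mom P1 p) \<and>
     (\<forall>(p, g)\<in>act_dom G (tot P1) (mom P1). \<sigma> (act P1 p g) = act P2 (\<sigma> p) g)"

end

theory Submission
  imports Defs
begin

text \<open>
  For \<open>(p, q)\<close> with \<open>p\<close> and \<open>q\<close> in one fibre, the division map returns the unique arrow \<open>g\<close> that
  carries \<open>p\<close> to \<open>q\<close>. A bundle morphism is equivariant and preserves the momentum, so the same \<open>g\<close>
  can act on \<open>\<sigma> p\<close> and carries it to \<open>\<sigma> q\<close>; by uniqueness in the second bundle, \<open>g\<close> is also the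
  quotient of \<open>\<sigma> p\<close> and \<open>\<sigma> q\<close> there. Existence (\<open>odot_elem_shear\<close>) and uniqueness
  (\<open>division_map_act\<close>) of \<open>g\<close> are the surjectivity and injectivity of the shear map
  (\<open>bij_betw_shear\<close>).
\<close>

lemma pts_act_mfd: "pts (act_mfd G P \<epsilon>) = act_dom G P \<epsilon>"
  by (auto simp: act_mfd_def submfd_def prod_mfd_def act_dom_def)

lemma pts_submfd_odot: "pts (submfd (prod_mfd (tot P) (tot P)) (odot P)) = odot P"
  by (auto simp: submfd_def prod_mfd_def odot_def)

lemma bij_betw_shear:
  assumes "principal_bundle G M P"
  shows "bij_betw (shear P) (act_dom G (tot P) (mom P)) (odot P)"
  using assms
  by (simp add: principal_bundle_def diffeomorphism_def pts_act_mfd pts_submfd_odot)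

lemma odot_elem_shear:
  assumes "principal_bundle G M P" and "(p, q) \<in> odot P"
  obtains g where "(p, g) \<in> act_dom G (tot P) (mom P)" and "q = act P p g"
proof -
  have "(p, q) \<in> shear P ` act_dom G (tot P) (mom P)"
    using bij_betw_imp_surj_on[OF bij_betw_shear[OF assms(1)]] assms(2) by simp
  then show thesis
    using that by (auto simp: shear_def)
qed

lemma division_map_act:
  assumes "principal_bundle G M P" and "(p, g) \<in> act_dom G (tot P) (mom P)"
  shows "division_map G P (p, act P p g) = g"
proof -
  have "inv_into (act_dom G (tot P) (mom P)) (shear P) (shear P (p, g)) = (p, g)"
    using bij_betw_imp_inj_on[OF bij_betw_shear[OF assms(1)]] assms(2) by (rule inv_into_f_f)
  then show ?thesis
    by (simp add: division_map_def shear_def)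
qed

text \<open>Preservation of the momentum is what makes every arrow that acts on \<open>p\<close> act on \<open>\<sigma> p\<close>.\<close>

lemma bundle_morphism_act_dom:
  assumes "bundle_morphism G P1 P2 \<sigma>" and "(p, g) \<in> act_dom G (tot P1) (mom P1)"
  shows "(\<sigma> p, g) \<in> act_dom G (tot P2) (mom P2)"
proof -
  have "continuous_map (mtop (tot P1)) (mtop (tot P2)) \<sigma>"
    using assms(1) by (simp add: bundle_morphism_def smooth_map_def)
  then have "\<sigma> \<in> pts (tot P1) \<rightarrow> pts (tot P2)"
    by (rule continuous_map_funspace)
  then show ?thesis
    using assms by (auto simp: bundle_morphism_def act_dom_def)
qed

theorem theorem5p11:
  fixes G :: "('g, 'x) groupoid"
    and M :: "'m mfd"
    and P1 :: "('p, 'm, 'x, 'g) gbundle"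
    and P2 :: "('q, 'm, 'x, 'g) gbundle"
    and \<sigma> :: "'p \<Rightarrow> 'q"
  assumes "lie_groupoid G"
    and "smooth_manifold M"
    and "principal_bundle G M P1"
    and "principal_bundle G M P2"
    and "bundle_morphism G P1 P2 \<sigma>"
  shows "\<forall>z\<in>odot P1. (division_map G P2 \<circ> map_prod \<sigma> \<sigma>) z = division_map G P1 z"
proof
  fix z
  assume "z \<in> odot P1"
  then obtain p q where z: "z = (p, q)" and "(p, q) \<in> odot P1"
    by (cases z) auto
  then obtain g where g: "(p, g) \<in> act_dom G (tot P1) (mom P1)" and q: "q = act P1 p g"
    using odot_elem_shear[OF assms(3)] by blast
  have "\<sigma> q = act P2 (\<sigma> p) g"
    using assms(5) g q by (auto simp: bundle_morphism_def)
  then have "division_map G P2 (\<sigma> p, \<sigma> q) = g"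
    using division_map_act[OF assms(4) bundle_morphism_act_dom[OF assms(5) g]] by simp
  also have "g = division_map G P1 (p, q)"
    using division_map_act[OF assms(3) g] q by simp
  finally show "(division_map G P2 \<circ> map_prod \<sigma> \<sigma>) z = division_map G P1 z"
    by (simp add: z)
qed

end
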